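(* If a group $G$ acts on an extended N-series $K_*$, then the Johnson filtration $\mathcal F^{K_*}_*(G)=(\mathcal F^{K_*}_m(G))_{m\ge0}$ is the largest extended N-series of $G$ acting on $K_*$. (That is, it is an extended N-series of $G$ acting on $K_*$, and every extended N-series $G'_*$ of $G$ acting on $K_*$ satisfies $G'_m\le \mathcal F^{K_*}_m(G)$ for all $m\ge 0$.)
   Context: Extended N-series: a descending series of groups $K_*=(K_m)_{m\ge 0}$, $K_0\ge K_1\ge K_2\ge\cdots$, with $[K_m,K_n]\le K_{m+n}$ for all $m,n\ge 0$. It is an extended N-series of a group $K$ if $K_0=K$. An action of a group $G$ on $K_*$ is an action (by automorphisms) of $G$ on the group $K_0$ such that $g(K_n)=K_n$ for all $g\in G$, $n\ge0$. Write $[g,k]=g(k)k^{-1}$ for $g\in G$, $k\in K_0$. An extended N-series $G_*$ of $G$ acts on $K_*$ (via the given action of $G=G_0$) if $[g,k]\in K_{m+n}$ for all $g\in G_m$, $k\in K_n$, $m,n\ge0$. The Johnson filtration of $G$ induced by $K_*$ is defined by $\mathcal F^{K_*}_m(G)=\{g\in G : [g,k]\in K_{m+n}\text{ for all } k\in K_n,\ n\ge 0\}$ for $m\ge0$. *)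

theory Defs
  imports "HOL-Algebra.Group_Action" "HOL-Algebra.Generated_Groups"
begin

definition commutator_subgroup ::
    "('a, 'c) monoid_scheme \<Rightarrow> 'a set \<Rightarrow> 'a set \<Rightarrow> 'a set"
  where "commutator_subgroup G A B =
    generate G (\<Union>a\<in>A. \<Union>b\<in>B. {a \<otimes>\<^bsub>G\<^esub> b \<otimes>\<^bsub>G\<^esub> inv\<^bsub>G\<^esub> a \<otimes>\<^bsub>G\<^esub> inv\<^bsub>G\<^esub> b})"

locale extended_N_series = group G for G (structure) +
  fixes Gs :: "nat \<Rightarrow> 'a set"
  assumes subgroups: "subgroup (Gs m) G"
    and zero: "Gs 0 = carrier G"
    and descending: "Gs (Suc m) \<subseteq> Gs m"
    and commutators: "commutator_subgroup G (Gs m) (Gs n) \<subseteq> Gs (m + n)"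

text \<open>
  The group acted upon is the degree-zero term of the series, i.e. \<open>K\<close> itself. An action
  by automorphisms is a homomorphism into \<^const>\<open>AutoGroup\<close>; each \<open>\<phi> g\<close> is
  extensional, so its values outside the carrier of \<open>K\<close> carry no information.
\<close>

locale acts_on_extended_N_series =
  K: extended_N_series K Ks + group_hom G "AutoGroup K" \<phi>
  for G :: "('a, 'c) monoid_scheme" (structure)
    and K :: "('b, 'd) monoid_scheme" (structure)
    and Ks :: "nat \<Rightarrow> 'b set"
    and \<phi> :: "'a \<Rightarrow> 'b \<Rightarrow> 'b" +
  assumes preserves: "g \<in> carrier G \<Longrightarrow> \<phi> g ` Ks n = Ks n"

text \<open>The bracket \<open>[g, k] = g(k) k\<inverse>\<close>, i.e. the commutator in the semidirect product.\<close>

definition action_bracket ::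
    "('b, 'd) monoid_scheme \<Rightarrow> ('a \<Rightarrow> 'b \<Rightarrow> 'b) \<Rightarrow> 'a \<Rightarrow> 'b \<Rightarrow> 'b"
  where "action_bracket K \<phi> g k = \<phi> g k \<otimes>\<^bsub>K\<^esub> inv\<^bsub>K\<^esub> k"

definition series_acts ::
    "(nat \<Rightarrow> 'a set) \<Rightarrow> ('b, 'd) monoid_scheme \<Rightarrow> (nat \<Rightarrow> 'b set) \<Rightarrow> ('a \<Rightarrow> 'b \<Rightarrow> 'b) \<Rightarrow> bool"
  where "series_acts Gs K Ks \<phi> \<longleftrightarrow>
    (\<forall>m n. \<forall>g\<in>Gs m. \<forall>k\<in>Ks n. action_bracket K \<phi> g k \<in> Ks (m + n))"

definition johnson_filtration ::
    "('a, 'c) monoid_scheme \<Rightarrow> ('b, 'd) monoid_scheme \<Rightarrow> (nat \<Rightarrow> 'b set) \<Rightarrow>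
      ('a \<Rightarrow> 'b \<Rightarrow> 'b) \<Rightarrow> nat \<Rightarrow> 'a set"
  where "johnson_filtration G K Ks \<phi> m =
    {g \<in> carrier G. \<forall>n. \<forall>k\<in>Ks n. action_bracket K \<phi> g k \<in> Ks (m + n)}"

end

theory Submission
  imports Defs
begin

text \<open>
  Write \<open>J\<^sub>m\<close> for the Johnson filtration. Maximality and the fact that \<open>J\<^sub>*\<close> acts on \<open>K\<^sub>*\<close> are
  immediate, because membership in \<open>J\<^sub>m\<close> is exactly the condition that an action imposes on the
  elements of degree \<open>m\<close>. The content is that \<open>J\<^sub>*\<close> is an extended N-series of \<open>G\<close>.

  Each \<open>J\<^sub>m\<close> is a subgroup because \<open>G\<close> preserves every \<open>K\<^sub>n\<close> and the bracket satisfies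
  \<open>[gh, k] = g([h, k]) [g, k]\<close> and \<open>[g\<inverse>, k] = g\<inverse>([g, k]\<inverse>)\<close>.

  For \<open>[J\<^sub>m, J\<^sub>n] \<le> J\<^bsub>m+n\<^esub>\<close> there is a direct substitute for the three subgroups lemma in the
  semidirect product: it suffices to compare \<open>g(h(k))\<close> and \<open>h(g(k))\<close> for \<open>k \<in> K\<^sub>p\<close>, because
  \<open>ghg\<inverse>h\<inverse>\<close> sends \<open>h(g(k))\<close> to \<open>g(h(k))\<close> and \<open>hg\<close> maps \<open>K\<^sub>p\<close> onto itself. With
  \<open>a = [g, k]\<close> and \<open>b = [h, k]\<close>, expanding gives
  \<open>g(h(k)) h(g(k))\<inverse> = [g, b] [b, a] [h, a]\<inverse>\<close>, and all three factors lie in \<open>K\<^bsub>m+n+p\<^esub>\<close>.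
\<close>

context extended_N_series
begin

lemma series_mem_carrier: "x \<in> Gs m \<Longrightarrow> x \<in> carrier G"
  using subgroup.subset[OF subgroups] by blast

lemma series_antimono: "m \<le> n \<Longrightarrow> Gs n \<subseteq> Gs m"
  by (rule lift_Suc_antimono_le[of Gs]) (use descending in auto)

lemma commutator_mem_series:
  assumes "a \<in> Gs m" "b \<in> Gs n"
  shows "a \<otimes> b \<otimes> inv a \<otimes> inv b \<in> Gs (m + n)"
proof -
  have "a \<otimes> b \<otimes> inv a \<otimes> inv b \<in> commutator_subgroup G (Gs m) (Gs n)"
    unfolding commutator_subgroup_def using assms by (blast intro: generate.incl)
  thus ?thesis using commutators by blast
qed

end

context acts_on_extended_N_series
begin

(* Otherwise \<phi> (g \<otimes> h) would be rewritten to a product in AutoGroup K before action_mult applies. *)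
declare hom_mult [simp del] hom_one [simp del] hom_inv [simp del]

lemma action_automorphism:
  assumes "g \<in> carrier G"
  shows "\<phi> g \<in> hom K K"
  using hom_closed[OF assms] by (simp add: AutoGroup_def auto_def)

lemma action_distrib:
  assumes "g \<in> carrier G" "x \<in> carrier K" "y \<in> carrier K"
  shows "\<phi> g (x \<otimes>\<^bsub>K\<^esub> y) = \<phi> g x \<otimes>\<^bsub>K\<^esub> \<phi> g y"
  using action_automorphism[OF assms(1)] assms(2,3) by (simp add: hom_def)

lemma action_closed:
  assumes "g \<in> carrier G" "x \<in> carrier K"
  shows "\<phi> g x \<in> carrier K"
  using action_automorphism[OF assms(1)] assms(2) by (auto simp: hom_def)

lemma action_inv:
  assumes "g \<in> carrier G" "x \<in> carrier K"
  shows "\<phi> g (inv\<^bsub>K\<^esub> x) = inv\<^bsub>K\<^esub> (\<phi> g x)"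
proof -
  interpret \<phi>g: group_hom K K "\<phi> g"
    using action_automorphism[OF assms(1)]
    by (simp add: group_hom_def group_hom_axioms_def K.is_group)
  show ?thesis using assms(2) by simp
qed

lemma action_mult:
  assumes "g \<in> carrier G" "h \<in> carrier G" "x \<in> carrier K"
  shows "\<phi> (g \<otimes> h) x = \<phi> g (\<phi> h x)"
  using hom_mult[OF assms(1,2)] hom_closed[OF assms(1)] hom_closed[OF assms(2)] assms(3)
  by (simp add: AutoGroup_def BijGroup_def auto_def compose_eq)

lemma action_one:
  assumes "x \<in> carrier K"
  shows "\<phi> \<one> x = x"
proof -
  have "\<one>\<^bsub>AutoGroup K\<^esub> = (\<lambda>x\<in>carrier K. x)"
    by (simp add: AutoGroup_def BijGroup_def)
  thus ?thesis using assms by (simp add: hom_one)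
qed

lemma action_mem_series: "g \<in> carrier G \<Longrightarrow> k \<in> Ks n \<Longrightarrow> \<phi> g k \<in> Ks n"
  using preserves by blast

lemma bracket_mem_carrier:
  assumes "g \<in> carrier G" "k \<in> carrier K"
  shows "action_bracket K \<phi> g k \<in> carrier K"
  using assms by (simp add: action_bracket_def action_closed)

lemma action_eq_bracket_mult:
  assumes "g \<in> carrier G" "k \<in> carrier K"
  shows "\<phi> g k = action_bracket K \<phi> g k \<otimes>\<^bsub>K\<^esub> k"
  using assms by (simp add: action_bracket_def action_closed K.m_assoc)

lemma bracket_mult:
  assumes "g \<in> carrier G" "h \<in> carrier G" "k \<in> carrier K"
  shows "action_bracket K \<phi> (g \<otimes> h) k
    = \<phi> g (action_bracket K \<phi> h k) \<otimes>\<^bsub>K\<^esub> action_bracket K \<phi> g k"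
proof -
  have "inv\<^bsub>K\<^esub> \<phi> g k \<otimes>\<^bsub>K\<^esub> (\<phi> g k \<otimes>\<^bsub>K\<^esub> inv\<^bsub>K\<^esub> k) = inv\<^bsub>K\<^esub> k"
    using assms by (simp add: action_closed flip: K.m_assoc)
  thus ?thesis
    using assms
    by (simp add: action_bracket_def action_mult action_closed action_distrib action_inv K.m_assoc)
qed

lemma bracket_inv:
  assumes "g \<in> carrier G" "k \<in> carrier K"
  shows "action_bracket K \<phi> (inv g) k = \<phi> (inv g) (inv\<^bsub>K\<^esub> action_bracket K \<phi> g k)"
proof -
  have "\<phi> (inv g) (\<phi> g k) = k"
    using assms by (simp flip: action_mult add: action_one)
  thus ?thesis
    using assms
    by (simp add: action_bracket_def action_closed action_distrib action_inv K.inv_mult_group)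
qed

lemma johnson_filtrationI:
  assumes "g \<in> carrier G"
    and "\<And>n k. k \<in> Ks n \<Longrightarrow> action_bracket K \<phi> g k \<in> Ks (m + n)"
  shows "g \<in> johnson_filtration G K Ks \<phi> m"
  using assms by (simp add: johnson_filtration_def)

lemma johnson_filtration_carrier: "g \<in> johnson_filtration G K Ks \<phi> m \<Longrightarrow> g \<in> carrier G"
  by (simp add: johnson_filtration_def)

lemma johnson_filtration_bracket:
  "g \<in> johnson_filtration G K Ks \<phi> m \<Longrightarrow> k \<in> Ks n \<Longrightarrow> action_bracket K \<phi> g k \<in> Ks (m + n)"
  by (simp add: johnson_filtration_def)

lemma johnson_filtration_subgroup: "subgroup (johnson_filtration G K Ks \<phi> m) G"
proof
  show "johnson_filtration G K Ks \<phi> m \<subseteq> carrier G"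
    using johnson_filtration_carrier by blast
next
  fix g h
  assume g: "g \<in> johnson_filtration G K Ks \<phi> m" and h: "h \<in> johnson_filtration G K Ks \<phi> m"
  note gG = johnson_filtration_carrier[OF g] and hG = johnson_filtration_carrier[OF h]
  show "g \<otimes> h \<in> johnson_filtration G K Ks \<phi> m"
  proof (rule johnson_filtrationI)
    fix n k
    assume k: "k \<in> Ks n"
    show "action_bracket K \<phi> (g \<otimes> h) k \<in> Ks (m + n)"
      unfolding bracket_mult[OF gG hG K.series_mem_carrier[OF k]]
      by (intro subgroup.m_closed[OF K.subgroups] action_mem_series
          johnson_filtration_bracket[OF g k] johnson_filtration_bracket[OF h k] gG)
  qed (use gG hG in simp)
next
  show "\<one> \<in> johnson_filtration G K Ks \<phi> m"
    by (rule johnson_filtrationI)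
      (simp_all add: action_bracket_def action_one K.series_mem_carrier
        subgroup.one_closed[OF K.subgroups])
next
  fix g
  assume g: "g \<in> johnson_filtration G K Ks \<phi> m"
  note gG = johnson_filtration_carrier[OF g]
  show "inv g \<in> johnson_filtration G K Ks \<phi> m"
  proof (rule johnson_filtrationI)
    fix n k
    assume k: "k \<in> Ks n"
    show "action_bracket K \<phi> (inv g) k \<in> Ks (m + n)"
      unfolding bracket_inv[OF gG K.series_mem_carrier[OF k]]
      by (intro action_mem_series subgroup.m_inv_closed[OF K.subgroups]
          johnson_filtration_bracket[OF g k] G.inv_closed gG)
  qed (use gG in simp)
qed

lemma johnson_filtration_zero: "johnson_filtration G K Ks \<phi> 0 = carrier G"
proof (intro equalityI subsetI johnson_filtrationI)
  fix g n k
  assume "g \<in> carrier G" "k \<in> Ks n"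
  thus "action_bracket K \<phi> g k \<in> Ks (0 + n)"
    by (simp add: action_bracket_def action_mem_series
        subgroup.m_closed[OF K.subgroups] subgroup.m_inv_closed[OF K.subgroups])
qed (auto dest: johnson_filtration_carrier)

lemma johnson_filtration_descending:
  "johnson_filtration G K Ks \<phi> (Suc m) \<subseteq> johnson_filtration G K Ks \<phi> m"
  using K.descending by (fastforce simp: johnson_filtration_def)

text \<open>
  The two orders of applying \<open>g\<close> and \<open>h\<close> both amount to multiplying \<open>k\<close> by \<open>a = [g, k]\<close> and
  \<open>b = [h, k]\<close>, but in opposite orders and up to the secondary brackets \<open>[g, b]\<close> and \<open>[h, a]\<close>:
  \<open>g(h(k)) = [g, b] b a k\<close> and \<open>h(g(k)) = [h, a] a b k\<close>. The identity is the quotient of these.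
\<close>

lemma action_commuted_quotient:
  fixes g h k
  defines "a \<equiv> action_bracket K \<phi> g k" and "b \<equiv> action_bracket K \<phi> h k"
  assumes g: "g \<in> carrier G" and h: "h \<in> carrier G" and k: "k \<in> carrier K"
  shows "\<phi> g (\<phi> h k) \<otimes>\<^bsub>K\<^esub> inv\<^bsub>K\<^esub> \<phi> h (\<phi> g k)
    = action_bracket K \<phi> g b \<otimes>\<^bsub>K\<^esub> (b \<otimes>\<^bsub>K\<^esub> a \<otimes>\<^bsub>K\<^esub> inv\<^bsub>K\<^esub> b \<otimes>\<^bsub>K\<^esub> inv\<^bsub>K\<^esub> a)
      \<otimes>\<^bsub>K\<^esub> inv\<^bsub>K\<^esub> action_bracket K \<phi> h a"
proof -
  have a: "a \<in> carrier K" and b: "b \<in> carrier K"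
    using g h k by (simp_all add: a_def b_def bracket_mem_carrier)
  note gb = bracket_mem_carrier[OF g b] and ha = bracket_mem_carrier[OF h a]
  have gk: "\<phi> g k = a \<otimes>\<^bsub>K\<^esub> k" and hk: "\<phi> h k = b \<otimes>\<^bsub>K\<^esub> k"
    using g h k by (simp_all add: a_def b_def action_eq_bracket_mult)
  have ghk: "\<phi> g (\<phi> h k) = action_bracket K \<phi> g b \<otimes>\<^bsub>K\<^esub> b \<otimes>\<^bsub>K\<^esub> (a \<otimes>\<^bsub>K\<^esub> k)"
    by (simp add: hk gk action_distrib g b k flip: action_eq_bracket_mult)
  have hgk: "\<phi> h (\<phi> g k) = action_bracket K \<phi> h a \<otimes>\<^bsub>K\<^esub> a \<otimes>\<^bsub>K\<^esub> (b \<otimes>\<^bsub>K\<^esub> k)"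
    by (simp add: hk gk action_distrib h a k flip: action_eq_bracket_mult)
  have cancel: "k \<otimes>\<^bsub>K\<^esub> (inv\<^bsub>K\<^esub> k \<otimes>\<^bsub>K\<^esub> z) = z" if "z \<in> carrier K" for z
    using that k by (simp flip: K.m_assoc)
  show ?thesis
    unfolding ghk hgk using a b k gb ha
    by (simp add: K.m_assoc K.inv_mult_group cancel)
qed

lemma johnson_filtration_commutator:
  assumes g: "g \<in> johnson_filtration G K Ks \<phi> m" and h: "h \<in> johnson_filtration G K Ks \<phi> n"
  shows "g \<otimes> h \<otimes> inv g \<otimes> inv h \<in> johnson_filtration G K Ks \<phi> (m + n)"
proof (rule johnson_filtrationI)
  note gG = johnson_filtration_carrier[OF g] and hG = johnson_filtration_carrier[OF h]
  show "g \<otimes> h \<otimes> inv g \<otimes> inv h \<in> carrier G" using gG hG by simp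
  fix p l
  assume l: "l \<in> Ks p"
  \<comment> \<open>Substitute \<open>l = h(g(k))\<close>, which turns the bracket of the commutator with \<open>l\<close> into the
    quotient of \<open>g(h(k))\<close> by \<open>h(g(k))\<close>.\<close>
  define k where "k = \<phi> (inv g) (\<phi> (inv h) l)"
  have k: "k \<in> Ks p" using gG hG l by (simp add: k_def action_mem_series)
  note lK = K.series_mem_carrier[OF l] and kK = K.series_mem_carrier[OF k]
  have "\<phi> h (\<phi> g k) = \<phi> (h \<otimes> (g \<otimes> (inv g \<otimes> inv h))) l"
    using gG hG lK by (simp add: k_def action_mult action_closed)
  also have "h \<otimes> (g \<otimes> (inv g \<otimes> inv h)) = \<one>"
    using gG hG by (metis G.inv_closed G.m_assoc G.l_one G.r_inv)
  finally have l_eq: "l = \<phi> h (\<phi> g k)" using lK by (simp add: action_one)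
  have "\<phi> (g \<otimes> h \<otimes> inv g \<otimes> inv h) l = \<phi> g (\<phi> h k)"
    using gG hG lK by (simp add: k_def action_mult action_closed)
  hence bracket_eq: "action_bracket K \<phi> (g \<otimes> h \<otimes> inv g \<otimes> inv h) l
      = \<phi> g (\<phi> h k) \<otimes>\<^bsub>K\<^esub> inv\<^bsub>K\<^esub> \<phi> h (\<phi> g k)"
    by (simp add: action_bracket_def flip: l_eq)
  define a where "a = action_bracket K \<phi> g k"
  define b where "b = action_bracket K \<phi> h k"
  have a: "a \<in> Ks (m + p)" and b: "b \<in> Ks (n + p)"
    using johnson_filtration_bracket[OF g k] johnson_filtration_bracket[OF h k]
    by (simp_all add: a_def b_def)
  have "action_bracket K \<phi> g b \<in> Ks (m + n + p)"
    using johnson_filtration_bracket[OF g b] by (simp add: add.assoc)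
  moreover have "action_bracket K \<phi> h a \<in> Ks (m + n + p)"
    using johnson_filtration_bracket[OF h a] by (simp add: ac_simps)
  \<comment> \<open>The commutator of \<open>b\<close> and \<open>a\<close> even has degree \<open>m + n + 2p\<close>.\<close>
  moreover have "b \<otimes>\<^bsub>K\<^esub> a \<otimes>\<^bsub>K\<^esub> inv\<^bsub>K\<^esub> b \<otimes>\<^bsub>K\<^esub> inv\<^bsub>K\<^esub> a \<in> Ks (m + n + p)"
    using K.commutator_mem_series[OF b a] K.series_antimono[of "m + n + p" "n + p + (m + p)"]
    by auto
  ultimately show "action_bracket K \<phi> (g \<otimes> h \<otimes> inv g \<otimes> inv h) l \<in> Ks (m + n + p)"
    unfolding bracket_eq action_commuted_quotient[OF gG hG kK, folded a_def b_def]
    by (blast intro: subgroup.m_closed[OF K.subgroups] subgroup.m_inv_closed[OF K.subgroups])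
qed

lemma johnson_filtration_extended_N_series:
  "extended_N_series G (johnson_filtration G K Ks \<phi>)"
proof (intro extended_N_series.intro extended_N_series_axioms.intro)
  fix m n
  show "commutator_subgroup G (johnson_filtration G K Ks \<phi> m) (johnson_filtration G K Ks \<phi> n)
      \<subseteq> johnson_filtration G K Ks \<phi> (m + n)"
    unfolding commutator_subgroup_def
    by (rule G.generate_subgroup_incl[OF _ johnson_filtration_subgroup])
      (auto intro: johnson_filtration_commutator)
qed (rule G.is_group johnson_filtration_subgroup johnson_filtration_zero johnson_filtration_descending)+

end

theorem proposition3p1:
  fixes G :: "('a, 'c) monoid_scheme"
    and K :: "('b, 'd) monoid_scheme"
    and Ks :: "nat \<Rightarrow> 'b set"
    and \<phi> :: "'a \<Rightarrow> 'b \<Rightarrow> 'b"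
  assumes "acts_on_extended_N_series G K Ks \<phi>"
  shows "extended_N_series G (johnson_filtration G K Ks \<phi>)
    \<and> series_acts (johnson_filtration G K Ks \<phi>) K Ks \<phi>
    \<and> (\<forall>Gs. extended_N_series G Gs \<and> series_acts Gs K Ks \<phi>
          \<longrightarrow> (\<forall>m. Gs m \<subseteq> johnson_filtration G K Ks \<phi> m))"
proof (intro conjI allI impI)
  show "extended_N_series G (johnson_filtration G K Ks \<phi>)"
    by (rule acts_on_extended_N_series.johnson_filtration_extended_N_series[OF assms])
  show "series_acts (johnson_filtration G K Ks \<phi>) K Ks \<phi>"
    by (simp add: series_acts_def johnson_filtration_def)
  fix Gs m
  assume "extended_N_series G Gs \<and> series_acts Gs K Ks \<phi>"
  thus "Gs m \<subseteq> johnson_filtration G K Ks \<phi> m"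
    by (auto simp: series_acts_def johnson_filtration_def
        dest: extended_N_series.series_mem_carrier)
qed

end
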